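(* Let $G=(V,E,w,\mu)$ be a weighted graph as in the context with $D_\mu<\infty$. Let $q>1$ and let $\psi:V\to[0,\infty)$ be bounded and not identically zero (so $\inf_{V}\psi\ge0$). There is a constant $C(V)>0$ depending only on the weighted graph such that the following holds. For $\lambda>0$ let $u$ be a positive solution of $$u_t-\Delta u=u\,|\log u|^q\ \text{ in } V\times(0,T),\qquad u(x,0)=\lambda\psi(x)\ \text{ for } x\in V,$$ and let $T_\lambda$ be its lifespan. If $x_i\in V$ is a vertex with $\deg(x_i)=m\ge1$ and $$\lambda\psi(x_i)>C(V)\exp\{m^{1/q}\},$$ then the positive solution $u$ (actually, $u(x_i,t)$) blows up in finite time, i.e. $T_\lambda<\infty$. Furthermore, for such a vertex $x_i$, $$\lim_{\lambda\to+\infty}\big(\log(\lambda\psi(x_i))\big)^{q-1}T_\lambda\ \le\ \frac1{q-1}\ \le\ \lim_{\lambda\to+\infty}\big(\log(\lambda\|\psi\|_\infty)\big)^{q-1}T_\lambda .$$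
   Context: Graph setting: $G=(V,E,w,\mu)$ is an infinite, locally finite, connected graph without loops or multiple edges, with edge weights $w_{xy}=w_{yx}>0$ for $xy\in E$ and vertex measure $\mu:V\to(0,\infty)$. Write $y\sim x$ if $xy\in E$; $\deg(x)$ is the number of neighbors of $x$. The Laplacian is $\Delta u(x)=\frac1{\mu(x)}\sum_{y\sim x}w_{xy}(u(y)-u(x))$, and $D_\mu:=\sup_{x\in V}\frac{1}{\mu(x)}\sum_{y\sim x}w_{xy}$. $\|\psi\|_\infty=\sup_{x\in V}|\psi(x)|$. Convention: $s|\log s|^q=0$ at $s=0$. Solutions: a (positive) solution on $[0,T)$ is a function $u$ on $V\times[0,T)$, positive on $V\times(0,T)$, such that for each $x\in V$, $u(x,\cdot)$ is continuous on $[0,T)$ and $C^1$ on $(0,T)$, the equation and initial condition hold, and $u\in L^\infty(V\times[0,T'])$ for every $0<T'<T$. The lifespan is $T_\lambda:=\sup\{T>0:\text{ the problem with initial datum }\lambda\psi\text{ admits a solution on }[0,T)\}$; if $T_\lambda<\infty$ it is called the blow-up time. *)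

theory Defs
  imports "HOL-Analysis.Analysis"
begin

definition nbrs :: "'v set set \<Rightarrow> 'v \<Rightarrow> 'v set" where
  "nbrs E x = {y. {x, y} \<in> E}"

definition deg :: "'v set set \<Rightarrow> 'v \<Rightarrow> nat" where
  "deg E x = card (nbrs E x)"

(* An edge is a two-element set of vertices, which rules out loops and multiple edges. *)
locale weighted_graph =
  fixes V :: "'v set" and E :: "'v set set"
    and w :: "'v \<Rightarrow> 'v \<Rightarrow> real" and \<mu> :: "'v \<Rightarrow> real"
  assumes infinite_V: "infinite V"
    and edges: "E \<subseteq> {{x, y} | x y. x \<in> V \<and> y \<in> V \<and> x \<noteq> y}"
    and locally_finite: "\<And>x. x \<in> V \<Longrightarrow> finite (nbrs E x)"
    and connected_graph: "\<And>x y. x \<in> V \<Longrightarrow> y \<in> V \<Longrightarrow> (\<lambda>a b. {a, b} \<in> E)\<^sup>*\<^sup>* x y"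
    and w_sym: "\<And>x y. {x, y} \<in> E \<Longrightarrow> w x y = w y x"
    and w_pos: "\<And>x y. {x, y} \<in> E \<Longrightarrow> w x y > 0"
    and \<mu>_pos: "\<And>x. x \<in> V \<Longrightarrow> \<mu> x > 0"

definition laplacian ::
  "'v set set \<Rightarrow> ('v \<Rightarrow> 'v \<Rightarrow> real) \<Rightarrow> ('v \<Rightarrow> real) \<Rightarrow> ('v \<Rightarrow> real) \<Rightarrow> 'v \<Rightarrow> real" where
  "laplacian E w \<mu> f x = (1 / \<mu> x) * (\<Sum>y\<in>nbrs E x. w x y * (f y - f x))"

definition D_mu ::
  "'v set \<Rightarrow> 'v set set \<Rightarrow> ('v \<Rightarrow> 'v \<Rightarrow> real) \<Rightarrow> ('v \<Rightarrow> real) \<Rightarrow> ereal" where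
  "D_mu V E w \<mu> = (SUP x\<in>V. ereal ((1 / \<mu> x) * (\<Sum>y\<in>nbrs E x. w x y)))"

definition sup_norm :: "'v set \<Rightarrow> ('v \<Rightarrow> real) \<Rightarrow> real" where
  "sup_norm V f = (SUP x\<in>V. \<bar>f x\<bar>)"

(* At s = 0 the factor s makes the value 0, as the usual convention demands. *)
definition log_source :: "real \<Rightarrow> real \<Rightarrow> real" where
  "log_source q s = s * \<bar>ln s\<bar> powr q"

(* All the requirements on a positive solution on [0, T) except boundedness on V \<times> [0, T']
   for T' < T.  Functions on V are total functions whose values outside V are irrelevant. *)
definition pointwise_solution ::
  "'v set \<Rightarrow> 'v set set \<Rightarrow> ('v \<Rightarrow> 'v \<Rightarrow> real) \<Rightarrow> ('v \<Rightarrow> real) \<Rightarrow> real \<Rightarrow> ('v \<Rightarrow> real)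
    \<Rightarrow> real \<Rightarrow> ('v \<Rightarrow> real \<Rightarrow> real) \<Rightarrow> bool" where
  "pointwise_solution V E w \<mu> q u0 T u \<longleftrightarrow>
     (\<forall>x\<in>V.
        (\<forall>t\<in>{0<..<T}. u x t > 0) \<and>
        continuous_on {0..<T} (u x) \<and>
        u x C1_differentiable_on {0<..<T} \<and>
        (\<forall>t\<in>{0<..<T}.
           deriv (u x) t - laplacian E w \<mu> (\<lambda>y. u y t) x = log_source q (u x t)) \<and>
        u x 0 = u0 x)"

definition positive_solution ::
  "'v set \<Rightarrow> 'v set set \<Rightarrow> ('v \<Rightarrow> 'v \<Rightarrow> real) \<Rightarrow> ('v \<Rightarrow> real) \<Rightarrow> real \<Rightarrow> ('v \<Rightarrow> real)
    \<Rightarrow> real \<Rightarrow> ('v \<Rightarrow> real \<Rightarrow> real) \<Rightarrow> bool" where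
  "positive_solution V E w \<mu> q u0 T u \<longleftrightarrow>
     pointwise_solution V E w \<mu> q u0 T u \<and>
     (\<forall>T'. 0 < T' \<and> T' < T \<longrightarrow> bounded {u x t | x t. x \<in> V \<and> t \<in> {0..T'}})"

definition lifespan ::
  "'v set \<Rightarrow> 'v set set \<Rightarrow> ('v \<Rightarrow> 'v \<Rightarrow> real) \<Rightarrow> ('v \<Rightarrow> real) \<Rightarrow> real \<Rightarrow> ('v \<Rightarrow> real)
    \<Rightarrow> ereal" where
  "lifespan V E w \<mu> q u0 =
     Sup (ereal ` {T. T > 0 \<and> (\<exists>u. positive_solution V E w \<mu> q u0 T u)})"

(* Blow-up in finite time at the vertex x: the value at x is bounded below by a function that
   tends to infinity at a finite time \<tau>, so that no solution lives beyond \<tau>.  This is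
   required even of solutions that need not be bounded on V \<times> [0, T'], so that it is the
   value at x, and not a loss of boundedness elsewhere in V, that ends the solution. *)
definition blows_up_at ::
  "'v set \<Rightarrow> 'v set set \<Rightarrow> ('v \<Rightarrow> 'v \<Rightarrow> real) \<Rightarrow> ('v \<Rightarrow> real) \<Rightarrow> real \<Rightarrow> ('v \<Rightarrow> real)
    \<Rightarrow> 'v \<Rightarrow> bool" where
  "blows_up_at V E w \<mu> q u0 x \<longleftrightarrow>
     (\<exists>\<tau>>0. \<exists>g :: real \<Rightarrow> real. filterlim g at_top (at_left \<tau>) \<and>
        (\<forall>T u. pointwise_solution V E w \<mu> q u0 T u \<longrightarrow>
           T \<le> \<tau> \<and> (\<forall>t\<in>{0..<T}. g t \<le> u x t)))"

end

theory Submission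
  imports Defs "HOL-Real_Asymp.Real_Asymp"
begin

text \<open>At a vertex \<open>x\<close> a positive solution satisfies \<open>u\<^sub>t \<ge> u \<bar>ln u\<bar>\<^sup>q - d u\<close>, where \<open>d\<close> is the
  total weight at \<open>x\<close> divided by \<open>\<mu> x\<close>, since the neighbours contribute nonnegatively. So
  \<open>y = ln u\<close> satisfies \<open>y' \<ge> y\<^sup>q - d\<close> as long as \<open>y \<ge> 0\<close>, and it blows up if it starts above
  \<open>max 1 D\<^sub>\<mu>\<close>, at a time asymptotic to \<open>y(0)\<^sup>1\<^sup>-\<^sup>q / (q - 1)\<close>.
  Conversely, the solution of \<open>z' = z (ln z)\<^sup>q\<close> that starts at the supremum \<open>M > 1\<close> of the datum
  exists up to time \<open>(ln M)\<^sup>1\<^sup>-\<^sup>q / (q - 1)\<close>, and below this barrier the monotone Duhamel iteration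
  from 0 converges to a solution, which is positive because the graph is connected. As
  \<open>ln (\<lambda> \<psi>(x)) / ln (\<lambda> \<parallel>\<psi>\<parallel>) \<rightarrow> 1\<close>, both limits equal \<open>1 / (q - 1)\<close>.\<close>

section \<open>The reaction term\<close>

lemma log_source_nonneg: "s \<ge> 0 \<Longrightarrow> log_source q s \<ge> 0"
  by (simp add: log_source_def)

lemma continuous_on_log_source:
  assumes "q > 0"
  shows "continuous_on {0..} (log_source q)"
proof -
  have "((\<lambda>s::real. s * (- ln s) powr q) \<longlongrightarrow> 0) (at_right 0)"
    using assms by real_asymp
  moreover have "eventually (\<lambda>s::real. s * (- ln s) powr q = log_source q s) (at_right 0)"
    using eventually_at_right_real[of 0 "1::real"]
    by (auto elim!: eventually_mono simp: log_source_def abs_if)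
  ultimately have zero: "(log_source q \<longlongrightarrow> 0) (at_right 0)"
    using Lim_transform_eventually by blast
  have "continuous (at s within {0..}) (log_source q)" if "s \<in> {0..}" for s
  proof (cases "s = 0")
    case True
    then show ?thesis
      using zero by (simp add: continuous_within log_source_def at_within_Ici_at_right)
  next
    case False
    with that have "s > 0" by simp
    \<comment> \<open>At s = 1 the base \<open>\<bar>ln s\<bar>\<close> is 0; \<open>powr\<close> is
      continuous there because the exponent q is positive.\<close>
    then have "isCont (\<lambda>s. s * \<bar>ln s\<bar> powr q) s"
      using assms by (auto intro!: continuous_intros)
    then show ?thesis
      unfolding log_source_def using continuous_at_imp_continuous_at_within by blast
  qed
  then show ?thesis
    by (simp add: continuous_on_eq_continuous_within)
qed

text \<open>The slope of \<^term>\<open>log_source q\<close> is \<open>L\<^sup>q - q L\<^sup>q\<^sup>-\<^sup>1\<close> with \<open>L = - ln s\<close> on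
  \<open>(0, 1)\<close>, hence at least \<open>- q\<^sup>q\<close>, although it is unbounded above near 0.\<close>

lemma log_source_shift_mono:
  assumes "q > 1"
  shows "mono_on {0..} (\<lambda>s. log_source q s + q powr q * s)"
proof (rule mono_onI)
  let ?h = "\<lambda>s. log_source q s + q powr q * s"
  have cont: "continuous_on {0..} ?h"
    using assms by (intro continuous_intros continuous_on_log_source) auto
  have low: "?h r \<le> ?h s" if "0 < r" "r \<le> s" "s \<le> 1" for r s
  proof (cases "r = s")
    case False
    show ?thesis
    proof (rule DERIV_nonneg_imp_increasing_open[of r s ?h])
      show "continuous_on {r..s} ?h"
        using cont by (rule continuous_on_subset) (use that in auto)
      fix y assume y: "r < y" "y < s"
      define L where "L = - ln y"
      have L: "L > 0" "0 < y" "y < 1" using y that by (auto simp: L_def)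
      have ev: "eventually (\<lambda>s. s \<in> {0<..<1}) (nhds y)"
        by (rule eventually_nhds_in_open) (use L in auto)
      have "((\<lambda>s. s * (- ln s) powr q + q powr q * s) has_real_derivative
             L powr q - q * L powr (q - 1) + q powr q) (at y)"
        using L by (auto intro!: derivative_eq_intros simp: L_def powr_diff field_simps)
      also have "?this \<longleftrightarrow> (?h has_real_derivative
             L powr q - q * L powr (q - 1) + q powr q) (at y)"
        by (rule DERIV_cong_ev)
          (use ev in \<open>auto elim!: eventually_mono simp: log_source_def abs_if\<close>)
      finally have d: "(?h has_real_derivative L powr q - q * L powr (q - 1) + q powr q) (at y)" .
      have "q * L powr (q - 1) \<le> L powr q + q powr q"
      proof (cases "L \<le> q")
        case True
        then have "q * L powr (q - 1) \<le> q * q powr (q - 1)"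
          using assms L by (intro mult_left_mono powr_mono2) auto
        also have "\<dots> = q powr q" using assms by (simp add: powr_diff)
        finally show ?thesis by (smt (verit) powr_ge_zero)
      next
        case False
        then have "q * L powr (q - 1) \<le> L * L powr (q - 1)"
          by (intro mult_right_mono) auto
        also have "\<dots> = L powr q" using L by (simp add: powr_diff)
        finally show ?thesis by (smt (verit) powr_ge_zero)
      qed
      with d show "\<exists>D. (?h has_real_derivative D) (at y) \<and> D \<ge> 0"
        by (intro exI[of _ "L powr q - q * L powr (q - 1) + q powr q"]) auto
    qed (use that in auto)
  qed auto
  have high: "?h r \<le> ?h s" if "1 \<le> r" "r \<le> s" for r s
    using that assms unfolding log_source_def
    by (intro add_mono mult_mono powr_mono2) auto
  fix r s :: real assume rs: "r \<in> {0..}" "s \<in> {0..}" "r \<le> s"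
  show "?h r \<le> ?h s"
  proof (cases "r = 0")
    case True
    then show ?thesis using rs log_source_nonneg[of s q] by (simp add: log_source_def)
  next
    case False
    then have "r > 0" using rs by simp
    \<comment> \<open>The absolute value in \<open>log_source\<close> changes branch at 1. Intervals
      that contain 1 in their interior are cut there.\<close>
    consider "s \<le> 1" | "r \<le> 1" "1 \<le> s" | "1 \<le> r" by linarith
    then show ?thesis
    proof cases
      case 1
      then show ?thesis using low \<open>r > 0\<close> rs(3) by blast
    next
      case 2
      then show ?thesis using low[of r 1] high[of 1 s] \<open>r > 0\<close> by linarith
    next
      case 3
      then show ?thesis using high rs(3) by blast
    qed
  qed
qed

section \<open>Existence below a barrier\<close>

lemma continuous_on_half_open:
  fixes f :: "real \<Rightarrow> real"
  assumes "\<And>b. 0 \<le> b \<Longrightarrow> b < T \<Longrightarrow> continuous_on {0..b} f"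
  shows "continuous_on {0..<T} f"
  unfolding continuous_on_eq_continuous_within
proof
  fix t assume t: "t \<in> {0..<T}"
  define b where "b = (t + T) / 2"
  have b: "t < b" "b < T" "0 \<le> b" using t by (auto simp: b_def)
  have "continuous (at t within {0..b}) f"
    using assms[of b] b t by (auto simp: continuous_on_eq_continuous_within)
  moreover have "at t within {0..b} = at t within {0..<T}"
    by (rule at_within_nhd[of _ "{..<b}"]) (use b t in auto)
  ultimately show "continuous (at t within {0..<T}) f" by simp
qed

section \<open>The Laplacian and the monotone Duhamel operator\<close>

context weighted_graph
begin

lemma nbrs_subset: "nbrs E x \<subseteq> V"
  using edges by (fastforce simp: nbrs_def doubleton_eq_iff)

lemma weight_nonneg: "y \<in> nbrs E x \<Longrightarrow> w x y \<ge> 0"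
  using w_pos by (force simp: nbrs_def intro: less_imp_le)

definition out_rate :: "'v \<Rightarrow> real" where
  "out_rate x = (1 / \<mu> x) * (\<Sum>y\<in>nbrs E x. w x y)"

lemma out_rate_nonneg: "x \<in> V \<Longrightarrow> out_rate x \<ge> 0"
  unfolding out_rate_def using \<mu>_pos[of x] weight_nonneg[of _ x]
  by (intro mult_nonneg_nonneg sum_nonneg) auto

text \<open>Splitting off the diagonal leaves a neighbour sum that is nonnegative and monotone for
  nonnegative functions. The diagonal part becomes an exponential rate in \<open>duhamel\<close> and
  a linear loss in the blow-up estimate.\<close>

lemma laplacian_alt:
  "laplacian E w \<mu> f x = (1 / \<mu> x) * (\<Sum>y\<in>nbrs E x. w x y * f y) - out_rate x * f x"
  by (simp add: laplacian_def out_rate_def right_diff_distrib sum_subtractf sum_distrib_right)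

text \<open>The summand \<open>q\<^sup>q u\<close> makes the reaction term nondecreasing in \<open>u\<close>; it is compensated by
  the exponential rate in \<open>duhamel\<close>.\<close>

definition gain :: "real \<Rightarrow> ('v \<Rightarrow> real \<Rightarrow> real) \<Rightarrow> 'v \<Rightarrow> real \<Rightarrow> real" where
  "gain q u x s = (1 / \<mu> x) * (\<Sum>y\<in>nbrs E x. w x y * u y s)
     + (log_source q (u x s) + q powr q * u x s)"

definition duhamel ::
  "real \<Rightarrow> ('v \<Rightarrow> real) \<Rightarrow> ('v \<Rightarrow> real \<Rightarrow> real) \<Rightarrow> 'v \<Rightarrow> real \<Rightarrow> real" where
  "duhamel q u0 u x t = exp (- ((out_rate x + q powr q) * t)) *
     (u0 x + integral {0..t} (\<lambda>s. exp ((out_rate x + q powr q) * s) * gain q u x s))"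

lemma gain_mono:
  assumes "q > 1" "x \<in> V" "\<And>y. y \<in> V \<Longrightarrow> 0 \<le> u y s \<and> u y s \<le> v y s"
  shows "gain q u x s \<le> gain q v x s"
proof -
  have "(1 / \<mu> x) * (\<Sum>y\<in>nbrs E x. w x y * u y s) \<le> (1 / \<mu> x) * (\<Sum>y\<in>nbrs E x. w x y * v y s)"
    using assms nbrs_subset[of x] weight_nonneg[of _ x] \<mu>_pos[of x]
    by (intro mult_left_mono sum_mono) auto
  moreover have "log_source q (u x s) + q powr q * u x s \<le> log_source q (v x s) + q powr q * v x s"
    using mono_onD[OF log_source_shift_mono[OF assms(1)], of "u x s" "v x s"]
      assms(3)[OF assms(2)] by simp
  ultimately show ?thesis unfolding gain_def by (rule add_mono)
qed

lemma gain_nonneg: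
  assumes "q > 1" "x \<in> V" "\<And>y. y \<in> V \<Longrightarrow> 0 \<le> u y s"
  shows "0 \<le> gain q u x s"
  using gain_mono[of q x "\<lambda>_ _. 0" s u] assms by (simp add: gain_def log_source_def)

lemma continuous_on_gain:
  assumes "q > 1" "x \<in> V" "\<And>y. y \<in> V \<Longrightarrow> continuous_on S (u y)"
    "\<And>y s. y \<in> V \<Longrightarrow> s \<in> S \<Longrightarrow> 0 \<le> u y s"
  shows "continuous_on S (gain q u x)"
  unfolding gain_def
proof (intro continuous_intros)
  show "continuous_on S (\<lambda>s. log_source q (u x s))"
    by (rule continuous_on_compose2[OF continuous_on_log_source]) (use assms in auto)
qed (use assms nbrs_subset[of x] in auto)

lemma tendsto_gain:
  assumes "q > 1" "x \<in> V" "\<And>y. y \<in> V \<Longrightarrow> (\<lambda>n. u n y s) \<longlonglongrightarrow> v y s"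
    "\<And>n y. y \<in> V \<Longrightarrow> 0 \<le> u n y s"
  shows "(\<lambda>n. gain q (u n) x s) \<longlonglongrightarrow> gain q v x s"
  unfolding gain_def
proof (intro tendsto_intros)
  have "0 \<le> v x s"
    using assms(2-4) by (intro LIMSEQ_le_const[of "\<lambda>n. u n x s"]) auto
  then show "(\<lambda>n. log_source q (u n x s)) \<longlonglongrightarrow> log_source q (v x s)"
    using assms
    by (intro continuous_on_tendsto_compose[OF continuous_on_log_source]) auto
qed (use assms nbrs_subset[of x] in auto)

end

text \<open>The barrier is a solution that is constant in space, so it has zero Laplacian. Its
  equation is imposed for all t < T, negative times included, which makes the derivative at 0
  two-sided; the explicit barrier built later satisfies this.\<close>

locale barrier = weighted_graph V E w \<mu>
  for V :: "'v set" and E w \<mu> +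
  fixes q T :: real and u0 :: "'v \<Rightarrow> real" and z :: "real \<Rightarrow> real"
  assumes q: "q > 1"
    and T: "T > 0"
    and z_nonneg: "\<And>t. t < T \<Longrightarrow> 0 \<le> z t"
    and z_ode: "\<And>t. t < T \<Longrightarrow> (z has_real_derivative log_source q (z t)) (at t)"
    and u0_nonneg: "\<And>x. x \<in> V \<Longrightarrow> 0 \<le> u0 x"
    and u0_le: "\<And>x. x \<in> V \<Longrightarrow> u0 x \<le> z 0"
begin

abbreviation rate :: "'v \<Rightarrow> real" where
  "rate x \<equiv> out_rate x + q powr q"

lemma z_cont: "b < T \<Longrightarrow> continuous_on {0..b} z"
  by (intro continuous_at_imp_continuous_on ballI DERIV_isCont[OF z_ode]) auto

text \<open>The neighbour sum of a spatially constant function is \<open>out_rate x\<close> times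
  its value, so the integrand is the derivative of \<open>exp (rate x * s) * z s\<close>. Hence
  \<open>z\<close> is a fixed point of \<open>duhamel\<close> with the datum
  \<open>z 0\<close>.\<close>

lemma duhamel_barrier:
  assumes "0 \<le> t" "t < T"
  shows "((\<lambda>s. exp (rate x * s) * gain q (\<lambda>_. z) x s)
     has_integral exp (rate x * t) * z t - z 0) {0..t}"
proof -
  have g: "gain q (\<lambda>_. z) x s = rate x * z s + log_source q (z s)" for s
    by (simp add: gain_def out_rate_def sum_distrib_left[symmetric] algebra_simps)
  have "((\<lambda>s. exp (rate x * s) * gain q (\<lambda>_. z) x s)
     has_integral exp (rate x * t) * z t - exp (rate x * 0) * z 0) {0..t}"
  proof (rule fundamental_theorem_of_calculus)
    fix s assume "s \<in> {0..t}"
    then have "((\<lambda>s. exp (rate x * s) * z s) has_real_derivative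
        exp (rate x * s) * gain q (\<lambda>_. z) x s) (at s within {0..t})"
      unfolding g using assms
      by (auto intro!: derivative_eq_intros DERIV_subset[OF z_ode] simp: algebra_simps)
    then show "((\<lambda>s. exp (rate x * s) * z s) has_vector_derivative
        exp (rate x * s) * gain q (\<lambda>_. z) x s) (at s within {0..t})"
      by (simp add: has_real_derivative_iff_has_vector_derivative)
  qed (use assms in auto)
  then show ?thesis by simp
qed

section \<open>The monotone iteration between 0 and the barrier\<close>

definition iterate :: "nat \<Rightarrow> 'v \<Rightarrow> real \<Rightarrow> real" where
  "iterate n = (duhamel q u0 ^^ n) (\<lambda>_ _. 0)"

lemma iterate_0: "iterate 0 x t = 0"
  by (simp add: iterate_def)

lemma iterate_Suc: "iterate (Suc n) = duhamel q u0 (iterate n)"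
  by (simp add: iterate_def)

lemma integrable_gain:
  assumes "x \<in> V" "b < T" "\<And>y. y \<in> V \<Longrightarrow> continuous_on {0..b} (u y)"
    "\<And>y s. y \<in> V \<Longrightarrow> s \<in> {0..b} \<Longrightarrow> 0 \<le> u y s" "t \<le> b"
  shows "(\<lambda>s. exp (rate x * s) * gain q u x s) integrable_on {0..t}"
proof (rule integrable_continuous_real)
  have "continuous_on {0..b} (\<lambda>s. exp (rate x * s) * gain q u x s)"
    using assms q by (intro continuous_intros continuous_on_gain) auto
  then show "continuous_on {0..t} (\<lambda>s. exp (rate x * s) * gain q u x s)"
    by (rule continuous_on_subset) (use assms in auto)
qed

text \<open>The operator is monotone in the function and in the datum, and it fixes \<open>z\<close>
  when the datum is \<open>z 0\<close>. As \<open>u0\<close> lies below \<open>z 0\<close>, the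
  order interval from 0 to \<open>z\<close> is preserved. Continuity is carried along to keep the
  integrals defined.\<close>

lemma iterate_invariant:
  assumes "b < T"
  shows "(\<forall>x\<in>V. continuous_on {0..b} (iterate n x) \<and>
    (\<forall>t\<in>{0..b}. 0 \<le> iterate n x t \<and> iterate n x t \<le> z t))"
proof (induction n)
  case 0
  then show ?case using z_nonneg assms by (auto simp: iterate_0[abs_def])
next
  case (Suc n)
  note IH = Suc
  show ?case
  proof (intro ballI conjI)
    fix x assume x: "x \<in> V"
    have int: "(\<lambda>s. exp (rate x * s) * gain q (iterate n) x s) integrable_on {0..t}" if "t \<le> b" for t
      using that IH by (intro integrable_gain[OF x assms]) auto
    show "continuous_on {0..b} (iterate (Suc n) x)"
      unfolding iterate_Suc duhamel_def
      by (intro continuous_intros indefinite_integral_continuous_1 int) auto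
    fix t assume t: "t \<in> {0..b}"
    have "0 \<le> integral {0..t} (\<lambda>s. exp (rate x * s) * gain q (iterate n) x s)"
      using t IH q x by (intro integral_nonneg int mult_nonneg_nonneg gain_nonneg) auto
    then show "0 \<le> iterate (Suc n) x t"
      unfolding iterate_Suc duhamel_def using u0_nonneg[OF x] by simp
    have "integral {0..t} (\<lambda>s. exp (rate x * s) * gain q (iterate n) x s)
       \<le> integral {0..t} (\<lambda>s. exp (rate x * s) * gain q (\<lambda>_. z) x s)"
      using t IH q x assms
      by (intro integral_le int has_integral_integrable[OF duhamel_barrier] mult_left_mono gain_mono)
         auto
    also have "\<dots> = exp (rate x * t) * z t - z 0"
      using t assms by (intro integral_unique duhamel_barrier) auto
    finally have "iterate (Suc n) x t \<le> exp (- (rate x * t)) * (exp (rate x * t) * z t)"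
      unfolding iterate_Suc duhamel_def using u0_le[OF x] by (intro mult_left_mono) auto
    also have "\<dots> = z t" by (simp add: exp_minus)
    finally show "iterate (Suc n) x t \<le> z t" .
  qed
qed

text \<open>The first iterate is nonnegative, hence above the zeroth; monotonicity of
  \<open>gain\<close> passes the comparison on.\<close>

lemma iterate_mono:
  assumes "b < T"
  shows "x \<in> V \<Longrightarrow> t \<in> {0..b} \<Longrightarrow> iterate n x t \<le> iterate (Suc n) x t"
proof (induction n arbitrary: x t)
  case 0
  then show ?case using iterate_invariant[OF assms, of "Suc 0"] by (auto simp: iterate_0)
next
  case (Suc n)
  note inv = iterate_invariant[OF assms]
  have "integral {0..t} (\<lambda>s. exp (rate x * s) * gain q (iterate n) x s)
     \<le> integral {0..t} (\<lambda>s. exp (rate x * s) * gain q (iterate (Suc n)) x s)"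
    using Suc q inv assms
    by (intro integral_le integrable_gain[where b = b] mult_left_mono gain_mono) auto
  then show ?case
    unfolding iterate_Suc[of n] iterate_Suc[of "Suc n"] unfolding duhamel_def
    by (intro mult_left_mono) (auto simp: iterate_Suc)
qed

section \<open>The limit of the iteration is a positive solution\<close>

definition sol :: "'v \<Rightarrow> real \<Rightarrow> real" where
  "sol x t = lim (\<lambda>n. iterate n x t)"

text \<open>Monotone bounded convergence gives the \<open>lim\<close> in \<open>sol\<close> its
  meaning, at vertices of V and times in [0, T).\<close>

lemma iterate_tendsto:
  assumes "x \<in> V" "0 \<le> t" "t < T"
  shows "(\<lambda>n. iterate n x t) \<longlonglongrightarrow> sol x t"
proof -
  have "incseq (\<lambda>n. iterate n x t)"
    using iterate_mono[of t x t] assms by (intro incseq_SucI) auto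
  moreover have "iterate n x t \<le> z t" for n
    using iterate_invariant[of t n] assms by auto
  ultimately obtain L where "(\<lambda>n. iterate n x t) \<longlonglongrightarrow> L"
    using incseq_convergent by blast
  then show ?thesis
    by (simp add: sol_def limI)
qed

lemma sol_nonneg: "x \<in> V \<Longrightarrow> 0 \<le> t \<Longrightarrow> t < T \<Longrightarrow> 0 \<le> sol x t"
  using iterate_invariant[of t] by (intro LIMSEQ_le_const[OF iterate_tendsto] exI[of _ 0]) auto

lemma sol_le: "x \<in> V \<Longrightarrow> 0 \<le> t \<Longrightarrow> t < T \<Longrightarrow> sol x t \<le> z t"
  using iterate_invariant[of t] by (intro LIMSEQ_le_const2[OF iterate_tendsto] exI[of _ 0]) auto

text \<open>Convergence is known only pointwise at this stage, so the limit is taken under the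
  integral by dominated convergence, with the integrand of the barrier as majorant. This also yields
  integrability of the limit integrand.\<close>

lemma sol_fixed_point:
  assumes x: "x \<in> V" and t: "0 \<le> t" "t < T"
  shows "(\<lambda>s. exp (rate x * s) * gain q sol x s) integrable_on {0..t}"
    and "sol x t = duhamel q u0 sol x t"
proof -
  let ?f = "\<lambda>u s. exp (rate x * s) * gain q u x s"
  note inv = iterate_invariant[OF t(2)]
  have int: "?f (iterate n) integrable_on {0..t}" for n
    using inv by (intro integrable_gain[OF x t(2)]) auto
  have intz: "?f (\<lambda>_. z) integrable_on {0..t}"
    using t by (intro has_integral_integrable[OF duhamel_barrier])
  have bound: "norm (?f (iterate n) s) \<le> ?f (\<lambda>_. z) s" if "s \<in> {0..t}" for n s
    using gain_nonneg[OF q x, of "iterate n" s] gain_mono[OF q x, of "iterate n" s "\<lambda>_. z"] inv that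
    by (auto simp: abs_mult)
  have lim: "(\<lambda>n. ?f (iterate n) s) \<longlonglongrightarrow> ?f sol s" if "s \<in> {0..t}" for s
    using that t inv by (intro tendsto_intros tendsto_gain[OF q x] iterate_tendsto) auto
  show "?f sol integrable_on {0..t}"
    by (rule dominated_convergence(1)[OF int intz bound lim])
  have "(\<lambda>n. integral {0..t} (?f (iterate n))) \<longlonglongrightarrow> integral {0..t} (?f sol)"
    by (rule dominated_convergence(2)[OF int intz bound lim])
  then have "(\<lambda>n. iterate (Suc n) x t) \<longlonglongrightarrow> duhamel q u0 sol x t"
    unfolding iterate_Suc duhamel_def by (intro tendsto_intros)
  moreover have "(\<lambda>n. iterate (Suc n) x t) \<longlonglongrightarrow> sol x t"
    using iterate_tendsto[OF x t] by (rule LIMSEQ_Suc)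
  ultimately show "sol x t = duhamel q u0 sol x t"
    by (rule LIMSEQ_unique[symmetric])
qed

text \<open>Regularity is recovered from the fixed-point equation: an indefinite integral is
  continuous.\<close>

lemma sol_cont:
  assumes "x \<in> V" "0 \<le> b" "b < T"
  shows "continuous_on {0..b} (sol x)"
proof -
  have "continuous_on {0..b} (duhamel q u0 sol x)"
    unfolding duhamel_def using assms sol_fixed_point(1)[of x b]
    by (intro continuous_intros indefinite_integral_continuous_1) auto
  then show ?thesis
    using assms by (subst continuous_on_cong[OF refl sol_fixed_point(2)]) auto
qed

lemma sol_deriv:
  assumes x: "x \<in> V" and t: "0 < t" "t < T"
  shows "(sol x has_real_derivative laplacian E w \<mu> (\<lambda>y. sol y t) x + log_source q (sol x t)) (at t)"
proof -
  \<comment> \<open>The midpoint makes t an interior point of a compact interval inside [0, T), so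
    the derivative of the integral is two-sided.\<close>
  define b where "b = (t + T) / 2"
  have b: "t < b" "b < T" "0 \<le> b" using t by (auto simp: b_def)
  let ?f = "\<lambda>s. exp (rate x * s) * gain q sol x s"
  have "continuous_on {0..b} ?f"
    using b sol_cont sol_nonneg by (intro continuous_intros continuous_on_gain[OF q x]) auto
  then have "((\<lambda>s. integral {0..s} ?f) has_real_derivative ?f t) (at t within {0..b})"
    using b t by (intro integral_has_real_derivative) auto
  then have I: "((\<lambda>s. integral {0..s} ?f) has_real_derivative ?f t) (at t)"
    using b t at_within_Icc_at[of 0 t b] by simp
  have *: "sol x t = exp (- (rate x * t)) * (u0 x + integral {0..t} ?f)"
    using sol_fixed_point(2)[OF x, of t] t by (simp add: duhamel_def)
  have "(duhamel q u0 sol x has_real_derivative gain q sol x t - rate x * sol x t) (at t)"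
    unfolding duhamel_def[abs_def] *
    by (rule derivative_eq_intros I refl)+ (simp add: algebra_simps flip: exp_add)
  \<comment> \<open>The auxiliary term \<open>q powr q * sol x t\<close> cancels here.\<close>
  moreover have "gain q sol x t - rate x * sol x t
      = laplacian E w \<mu> (\<lambda>y. sol y t) x + log_source q (sol x t)"
    by (simp add: laplacian_alt gain_def algebra_simps)
  moreover have "eventually (\<lambda>s. s \<in> {0<..<T}) (nhds t)"
    by (rule eventually_nhds_in_open) (use t in auto)
  then have "eventually (\<lambda>s. duhamel q u0 sol x s = sol x s) (nhds t)"
    by eventually_elim (use sol_fixed_point(2)[OF x] in auto)
  ultimately show ?thesis
    using DERIV_cong_ev[OF refl _ refl] by metis
qed

text \<open>Positivity spreads along a path from \<open>x0\<close>. At \<open>x0\<close> the datum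
  is positive and the integral nonnegative. If a neighbour of x is positive at some time before t,
  the continuous nonnegative integrand at x is positive there, so its integral up to t is
  positive.\<close>

lemma sol_pos:
  assumes x0: "x0 \<in> V" "u0 x0 > 0" and x: "x \<in> V" and t: "0 < t" "t < T"
  shows "sol x t > 0"
proof -
  let ?f = "\<lambda>x s. exp (rate x * s) * gain q sol x s"
  have nonneg: "0 \<le> ?f x s" if "x \<in> V" "s \<in> {0..<T}" for x s
    using gain_nonneg[OF q, of x sol s] sol_nonneg that by auto
  have "(\<lambda>a b. {a, b} \<in> E)\<^sup>*\<^sup>* x0 x"
    by (rule connected_graph[OF x0(1) x])
  then have "\<forall>t. 0 < t \<longrightarrow> t < T \<longrightarrow> sol x t > 0"
  proof (induction rule: rtranclp_induct)
    case base
    show ?case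
    proof (intro allI impI)
      fix t assume t: "0 < t" "t < T"
      have "0 \<le> integral {0..t} (?f x0)"
        using sol_fixed_point(1)[OF x0(1)] t nonneg[OF x0(1)] by (intro integral_nonneg) auto
      then show "sol x0 t > 0"
        using sol_fixed_point(2)[OF x0(1), of t] t x0 by (simp add: duhamel_def)
    qed
  next
    case (step y x)
    have xy: "y \<in> V" "x \<in> V" "{x, y} \<in> E" "y \<in> nbrs E x"
      using step.hyps(2) nbrs_subset[of x] nbrs_subset[of y]
      by (auto simp: nbrs_def insert_commute)
    show ?case
    proof (intro allI impI)
      fix t assume t: "0 < t" "t < T"
      \<comment> \<open>The time t / 2 stays away from 0, where the neighbour may still
        vanish.\<close>
      have fpos: "?f x (t / 2) > 0"
      proof -
        have s: "0 < t / 2" "t / 2 < T" using t by auto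
        have "0 < w x y * sol y (t / 2)"
          using step.IH s w_pos[OF xy(3)] by auto
        also have "\<dots> \<le> (\<Sum>y\<in>nbrs E x. w x y * sol y (t / 2))"
          using xy s nbrs_subset[of x] weight_nonneg[of _ x] sol_nonneg locally_finite[of x]
          by (intro member_le_sum) (auto intro!: mult_nonneg_nonneg)
        finally have "0 < gain q sol x (t / 2)"
          unfolding gain_def using \<mu>_pos[OF xy(2)] sol_nonneg[OF xy(2), of "t / 2"] s
            log_source_nonneg[of "sol x (t / 2)" q]
          by (intro add_pos_nonneg add_nonneg_nonneg mult_pos_pos) auto
        then show ?thesis by simp
      qed
      have cont: "continuous_on {0..t} (?f x)"
        using t sol_cont sol_nonneg by (intro continuous_intros continuous_on_gain[OF q xy(2)]) auto
      have "integral {0..t} (?f x) \<ge> 0"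
        using t nonneg[OF xy(2)] by (intro integral_nonneg integrable_continuous_real cont) auto
      moreover have "integral {0..t} (?f x) \<noteq> 0"
        using integral_eq_0_iff[OF cont t(1)] nonneg[OF xy(2)] t fpos
        by (auto dest!: bspec[of _ _ "t / 2"])
      ultimately have "integral {0..t} (?f x) > 0" by simp
      then show "sol x t > 0"
        using sol_fixed_point(2)[OF xy(2), of t] t u0_nonneg[OF xy(2)]
        by (simp add: duhamel_def)
    qed
  qed
  with t show ?thesis by blast
qed

lemma positive_solution_sol:
  assumes "x0 \<in> V" "u0 x0 > 0"
  shows "positive_solution V E w \<mu> q u0 T sol"
  unfolding positive_solution_def pointwise_solution_def
proof (intro conjI ballI allI impI)
  fix x assume x: "x \<in> V"
  show cont: "continuous_on {0..<T} (sol x)"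
    by (rule continuous_on_half_open) (rule sol_cont[OF x])
  have subset: "{0<..<T} \<subseteq> {0..<T}" by auto
  have contl: "continuous_on {0<..<T} (\<lambda>t. laplacian E w \<mu> (\<lambda>y. sol y t) x + log_source q (sol x t))"
    unfolding laplacian_def
  proof (intro continuous_intros)
    show c: "continuous_on {0<..<T} (sol x)"
      using cont subset by (rule continuous_on_subset)
    show "continuous_on {0<..<T} (sol y)" if "y \<in> nbrs E x" for y
      using continuous_on_half_open[OF sol_cont] nbrs_subset[of x] that subset
      by (meson continuous_on_subset subsetD)
    show "continuous_on {0<..<T} (\<lambda>t. log_source q (sol x t))"
      by (rule continuous_on_compose2[OF continuous_on_log_source c]) (use q sol_nonneg[OF x] in auto)
  qed
  show "sol x C1_differentiable_on {0<..<T}"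
    unfolding C1_differentiable_on_def
    using contl sol_deriv[OF x]
    by (intro exI[of _ "\<lambda>t. laplacian E w \<mu> (\<lambda>y. sol y t) x + log_source q (sol x t)"])
       (auto simp: has_real_derivative_iff_has_vector_derivative)
  show "sol x 0 = u0 x"
    using sol_fixed_point(2)[OF x, of 0] T by (simp add: duhamel_def)
  fix t assume t: "t \<in> {0<..<T}"
  show "0 < sol x t" using sol_pos[OF assms x] t by auto
  show "deriv (sol x) t - laplacian E w \<mu> (\<lambda>y. sol y t) x = log_source q (sol x t)"
    using DERIV_imp_deriv[OF sol_deriv[OF x, of t]] t by auto
next
  fix T' assume T': "0 < T' \<and> T' < T"
  have "compact (z ` {0..T'})"
    using T' by (intro compact_continuous_image z_cont) auto
  then obtain B where B: "\<And>t. t \<in> {0..T'} \<Longrightarrow> norm (z t) \<le> B"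
    by (metis bounded_iff compact_imp_bounded imageI)
  have "\<bar>sol x t\<bar> \<le> B" if "x \<in> V" "t \<in> {0..T'}" for x t
    using sol_nonneg[of x t] sol_le[of x t] B[of t] that T' by auto
  then show "bounded {sol x t |x t. x \<in> V \<and> t \<in> {0..T'}}"
    by (auto simp: bounded_iff)
qed

end

section \<open>Lower bound for the lifespan\<close>

context weighted_graph
begin

text \<open>The barrier comes from separating variables in z' = z (ln z)^q with z(0) = M: the
  quantity (ln z)^(1-q) decreases linearly with slope -(q-1). It is called \<open>A\<close>, and its
  zero is the time claimed.\<close>

lemma lifespan_ge:
  assumes q: "q > 1" and M: "M > 1" and u0: "\<And>x. x \<in> V \<Longrightarrow> 0 \<le> u0 x \<and> u0 x \<le> M"
    and x0: "x0 \<in> V" "u0 x0 > 0"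
  shows "ereal (ln M powr (1 - q) / (q - 1)) \<le> lifespan V E w \<mu> q u0"
proof -
  define A where "A = (\<lambda>t. ln M powr (1 - q) - (q - 1) * t)"
  define T where "T = ln M powr (1 - q) / (q - 1)"
  define z where "z = (\<lambda>t. exp (A t powr (- (1 / (q - 1)))))"
  have lnM: "ln M > 0" using M by simp
  have T: "T > 0" using q lnM by (simp add: T_def)
  have A: "A t > 0" if "t < T" for t
    using that q by (simp add: A_def T_def field_simps)
  have "barrier V E w \<mu> q T u0 z"
  proof unfold_locales
    show "(z has_real_derivative log_source q (z t)) (at t)" if "t < T" for t
    proof -
      let ?p = "1 / (q - 1)"
      \<comment> \<open>This identity turns the power produced by differentiation into a q-th
        power.\<close>
      have e: "- ?p - 1 = - ?p * q" using q by (simp add: field_simps)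
      have dA: "(A has_real_derivative - (q - 1)) (at t)"
        unfolding A_def by (auto intro!: derivative_eq_intros)
      have "((\<lambda>t. A t powr (- ?p)) has_real_derivative
          - ?p * A t powr (- ?p - 1) * - (q - 1)) (at t)"
        using DERIV_fun_powr[OF dA A[OF that], of "- ?p"] by (simp only: of_nat_1)
      moreover have "- ?p * X * - (q - 1) = X" for X
        using q by (simp add: field_simps)
      then have "- ?p * A t powr (- ?p - 1) * - (q - 1) = (A t powr (- ?p)) powr q"
        unfolding e powr_powr .
      ultimately have "((\<lambda>t. A t powr (- ?p)) has_real_derivative (A t powr (- ?p)) powr q) (at t)"
        by simp
      from DERIV_fun_exp[OF this] show ?thesis
        by (simp add: z_def log_source_def)
    qed
    have "(1 - q) * - (1 / (q - 1)) = 1" using q by (simp add: field_simps)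
    then have "(ln M powr (1 - q)) powr (- (1 / (q - 1))) = ln M"
      unfolding powr_powr using lnM by simp
    then have "z 0 = M"
      using M by (simp add: z_def A_def)
    then show "u0 x \<le> z 0" if "x \<in> V" for x using u0[OF that] by simp
  qed (use q T u0 in \<open>auto simp: z_def\<close>)
  then interpret barrier V E w \<mu> q T u0 z .
  show ?thesis
    unfolding lifespan_def T_def[symmetric]
    using positive_solution_sol[OF x0] T by (intro Sup_upper) auto
qed

end

section \<open>Blow-up\<close>

text \<open>If f fell below its initial value, consider the last time it reaches a level c slightly
  below \<open>f 0\<close>. The differential inequality makes the derivative positive there, so f
  exceeds c again just afterwards, a contradiction.\<close>

lemma log_source_stays_above:
  fixes f f' :: "real \<Rightarrow> real"
  assumes q: "q > 1" and cont: "continuous_on {0..<T} f"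
    and f: "\<And>s. 0 < s \<Longrightarrow> s < T \<Longrightarrow> f s > 0"
    and deriv: "\<And>s. 0 < s \<Longrightarrow> s < T \<Longrightarrow> (f has_real_derivative f' s) (at s)"
    and f': "\<And>s. 0 < s \<Longrightarrow> s < T \<Longrightarrow> log_source q (f s) - D * f s \<le> f' s"
    and v: "f 0 = exp v" "v > 1" "v > D"
    and t: "0 \<le> t" "t < T"
  shows "f 0 \<le> f t"
proof (rule ccontr)
  assume "\<not> f 0 \<le> f t"
  then have lt: "f t < f 0" by simp
  then have "t > 0" using t by (cases "t = 0") auto
  then have "f t > 0" using f t by simp
  with lt v have "max (max 1 D) (ln (f t)) < v"
    by (metis exp_less_cancel_iff exp_ln max_less_iff_conj)
  \<comment> \<open>With r above 1 and D, the rate \<open>r powr q - D\<close> is positive at level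
    \<open>exp r\<close>; r above \<open>ln (f t)\<close> puts f t below the level. Strictness of r
    < v forces the last time to be positive, where the derivative is available.\<close>
  then obtain r where r: "max (max 1 D) (ln (f t)) < r" "r < v"
    using dense by blast
  define c where "c = exp r"
  have c: "f t < c" "c < f 0"
    using r v \<open>f t > 0\<close> by (auto simp: c_def) (metis exp_less_cancel_iff exp_ln)
  have cont_t: "continuous_on {0..t} f"
    using cont by (rule continuous_on_subset) (use t in auto)
  define S where "S = {0..t} \<inter> f -` {c..}"
  have "compact S"
    unfolding S_def
    using continuous_closed_preimage[OF cont_t closed_atLeastAtMost closed_atLeast]
    by (meson bounded_closed_interval bounded_subset compact_eq_bounded_closed inf_le1)
  moreover have "S \<noteq> {}" using c t by (auto simp: S_def)
  ultimately obtain s where s: "s \<in> S" "\<And>y. y \<in> S \<Longrightarrow> y \<le> s"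
    using compact_attains_sup by metis
  have s': "0 \<le> s" "s \<le> t" "c \<le> f s" "s \<noteq> t" using s(1) c by (auto simp: S_def)
  have "continuous_on {s..t} f"
    using cont_t by (rule continuous_on_subset) (use s' in auto)
  then obtain y where y: "s \<le> y" "y \<le> t" "f y = c"
    using IVT2'[of f t c s] s' c by auto
  have "y \<le> s" using y s' by (intro s(2)) (auto simp: S_def)
  with y have fs: "f s = c" by simp
  then have "s > 0" using s' c by (cases "s = 0") auto
  have "0 < c * (r powr q - D)"
  proof -
    have "r powr 1 \<le> r powr q" using q r by (intro powr_mono) auto
    then show ?thesis using r by (simp add: c_def)
  qed
  also have "\<dots> = log_source q (f s) - D * f s"
    using r unfolding fs by (simp add: c_def log_source_def algebra_simps)
  also have "\<dots> \<le> f' s" using \<open>s > 0\<close> s' t by (intro f') auto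
  finally have "f' s > 0" .
  moreover have "(f has_real_derivative f' s) (at s)"
    using \<open>s > 0\<close> s' t by (intro deriv) auto
  ultimately obtain d where d: "d > 0" "\<And>h. 0 < h \<Longrightarrow> h < d \<Longrightarrow> f s < f (s + h)"
    using DERIV_pos_inc_right by blast
  define h where "h = min (d / 2) (t - s)"
  have h: "0 < h" "h < d" "s + h \<le> t" using d s' by (auto simp: h_def)
  have "s + h \<le> s"
    using h s' d(2)[of h] fs by (intro s(2)) (auto simp: S_def)
  with h show False by simp
qed

text \<open>With \<open>y = ln f\<close> the hypothesis reads \<open>y' \<ge> y\<^sup>q - D\<close>, and \<open>y \<ge> v\<close> turns this into
  \<open>y' \<ge> (1 - D / v\<^sup>q) y\<^sup>q\<close>, which is integrated explicitly.\<close>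

lemma log_source_ln_powr_le:
  fixes f f' :: "real \<Rightarrow> real"
  assumes q: "q > 1" and D: "D \<ge> 0" and cont: "continuous_on {0..<T} f"
    and f: "\<And>s. 0 < s \<Longrightarrow> s < T \<Longrightarrow> f s > 0"
    and deriv: "\<And>s. 0 < s \<Longrightarrow> s < T \<Longrightarrow> (f has_real_derivative f' s) (at s)"
    and f': "\<And>s. 0 < s \<Longrightarrow> s < T \<Longrightarrow> log_source q (f s) - D * f s \<le> f' s"
    and v: "f 0 = exp v" "v > 1" "v > D"
    and t: "0 \<le> t" "t < T"
  shows "ln (f t) > 0"
    and "ln (f t) powr (1 - q) \<le> v powr (1 - q) - (q - 1) * (1 - D / v powr q) * t"
proof -
  have ge: "v \<le> ln (f s)" "f s > 0" if "0 \<le> s" "s < T" for s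
  proof -
    have "exp v \<le> f s"
      using log_source_stays_above[OF q cont f deriv f' v that] v by simp
    then show "f s > 0" by (rule less_le_trans[OF exp_gt_zero])
    then show "v \<le> ln (f s)" using \<open>exp v \<le> f s\<close> by (simp add: ln_ge_iff)
  qed
  show "ln (f t) > 0" using ge(1)[OF t] v(2) by linarith
  define k where "k = 1 - D / v powr q"
  \<comment> \<open>With y = ln f, the derivative of y^(1-q) is -(q-1) y^(-q) y', which is at most
    -(q-1) k; the linear term compensates exactly this bound.\<close>
  define \<phi> where "\<phi> = (\<lambda>s. ln (f s) powr (1 - q) + (q - 1) * k * s)"
  have "\<phi> t \<le> \<phi> 0"
  proof (rule DERIV_nonpos_imp_decreasing_open[OF t(1)])
    have "continuous_on {0..t} f"
      using cont by (rule continuous_on_subset) (use t in auto)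
    then show "continuous_on {0..t} \<phi>"
      unfolding \<phi>_def
    proof (intro continuous_intros)
      show "\<forall>s\<in>{0..t}. f s \<noteq> 0" using ge(2) t by fastforce
      show "\<forall>s\<in>{0..t}. ln (f s) \<noteq> 0"
      proof
        fix s assume "s \<in> {0..t}"
        then have "ln (f s) > 0" using ge(1)[of s] t v(2) by auto
        then show "ln (f s) \<noteq> 0" by (rule less_imp_neq[THEN not_sym])
      qed
    qed
    fix s assume s: "0 < s" "s < t"
    define y where "y = ln (f s)"
    have "y \<ge> v" "f s > 0" unfolding y_def using ge[of s] s t by simp_all
    with v have y: "y \<ge> v" "y > 0" "f s > 0" by simp_all
    have "(\<phi> has_real_derivative (1 - q) * y powr (- q) * (f' s / f s) + (q - 1) * k) (at s)"
    proof -
      have "((\<lambda>s. ln (f s)) has_real_derivative f' s / f s) (at s)"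
        using deriv[of s] y s t by (auto intro!: derivative_eq_intros simp: field_simps)
      from DERIV_fun_powr[OF this, of "1 - q"] y
      have "((\<lambda>s. ln (f s) powr (1 - q)) has_real_derivative
          (1 - q) * y powr (- q) * (f' s / f s)) (at s)"
        by (simp add: y_def)
      from DERIV_add[OF this DERIV_cmult_Id[of "(q - 1) * k"]] show ?thesis
        unfolding \<phi>_def .
    qed
    moreover have "(1 - q) * y powr (- q) * (f' s / f s) + (q - 1) * k \<le> 0"
    proof -
      have "log_source q (f s) - D * f s = f s * (y powr q - D)"
        using y by (simp add: log_source_def y_def algebra_simps)
      then have "y powr q - D \<le> f' s / f s"
        using f'[of s] s t y by (simp add: pos_le_divide_eq mult.commute)
      moreover have "D * v powr q \<le> D * y powr q"
        using D y v q by (intro mult_left_mono powr_mono2) auto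
      then have "k * y powr q \<le> y powr q - D"
        using v by (simp add: k_def field_simps)
      ultimately have "k * y powr q \<le> f' s / f s" by simp
      then have "y powr (- q) * (k * y powr q) \<le> y powr (- q) * (f' s / f s)"
        by (intro mult_left_mono) auto
      moreover have "y powr (- q) * (k * y powr q) = k"
        using y by (simp add: powr_minus)
      ultimately have "(q - 1) * k \<le> (q - 1) * (y powr (- q) * (f' s / f s))"
        using q by (intro mult_left_mono) auto
      moreover have "(1 - q) * Y * Z = - ((q - 1) * (Y * Z))" for Y Z
        by (simp add: algebra_simps)
      ultimately show ?thesis by simp
    qed
    ultimately show "\<exists>d. (\<phi> has_real_derivative d) (at s) \<and> d \<le> 0" by blast
  qed
  then show "ln (f t) powr (1 - q) \<le> v powr (1 - q) - (q - 1) * (1 - D / v powr q) * t"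
    using v by (simp add: \<phi>_def k_def)
qed

text \<open>The time at which the upper bound of \<open>log_source_ln_powr_le\<close> for the power
  of \<open>ln (f t)\<close> reaches 0. For D = 0 it is the blow-up time of y' = y^q with y(0) =
  v.\<close>

definition blowup_time :: "real \<Rightarrow> real \<Rightarrow> real \<Rightarrow> real" where
  "blowup_time q D v = v powr (1 - q) / ((q - 1) * (1 - D / v powr q))"

lemma blowup_factor_pos:
  fixes q v D :: real
  assumes "q > 1" "v > 1" "v > D"
  shows "1 - D / v powr q > 0"
proof -
  have "v powr 1 \<le> v powr q" using assms by (intro powr_mono) auto
  then show ?thesis using assms by simp
qed

section \<open>Blow-up at a vertex\<close>

context weighted_graph
begin

text \<open>Dropping the nonnegative neighbour sum leaves the scalar inequality with D =
  \<open>out_rate x\<close>. It is stated for \<open>pointwise_solution\<close>, the notion over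
  which \<open>blows_up_at\<close> quantifies.\<close>

lemma pointwise_solution_lower_bound:
  assumes q: "q > 1" and x: "x \<in> V"
    and v: "u0 x = exp v" "v > 1" "v > out_rate x"
    and u: "pointwise_solution V E w \<mu> q u0 T u" and t: "0 \<le> t" "t < T"
  defines "A \<equiv> v powr (1 - q) - (q - 1) * (1 - out_rate x / v powr q) * t"
  shows "A > 0" "exp (A powr (- (1 / (q - 1)))) \<le> u x t"
proof -
  note u = u[unfolded pointwise_solution_def]
  have deriv: "(u x has_real_derivative deriv (u x) s) (at s)" if s: "0 < s" "s < T" for s
  proof -
    have "u x C1_differentiable_on {0<..<T}" using u x by blast
    then obtain d where "(u x has_real_derivative d s) (at s)"
      using s unfolding C1_differentiable_on_def has_real_derivative_iff_has_vector_derivative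
      by (meson greaterThanLessThan_iff)
    then show ?thesis using DERIV_imp_deriv by metis
  qed
  have deriv_ge: "log_source q (u x s) - out_rate x * u x s \<le> deriv (u x) s"
    if "0 < s" "s < T" for s
  proof -
    have "0 \<le> (1 / \<mu> x) * (\<Sum>y\<in>nbrs E x. w x y * u y s)"
      using u that nbrs_subset[of x] weight_nonneg[of _ x] \<mu>_pos[OF x]
      by (intro mult_nonneg_nonneg sum_nonneg) (auto intro!: less_imp_le)
    then have "- (out_rate x * u x s) \<le> laplacian E w \<mu> (\<lambda>y. u y s) x"
      unfolding laplacian_alt by simp
    moreover have "deriv (u x) s - laplacian E w \<mu> (\<lambda>y. u y s) x = log_source q (u x s)"
      using u x that by auto
    ultimately show ?thesis by linarith
  qed
  have "continuous_on {0..<T} (u x)" "\<And>s. 0 < s \<Longrightarrow> s < T \<Longrightarrow> u x s > 0" "u x 0 = exp v"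
    using u x v by auto
  note decay = log_source_ln_powr_le[OF q out_rate_nonneg[OF x] this(1,2) deriv deriv_ge this(3) v(2,3) t]
  have pos: "0 < ln (u x t) powr (1 - q)" using decay(1) by simp
  then show "A > 0" using decay(2) unfolding A_def by linarith
  \<comment> \<open>The negative exponent reverses the order and undoes the power 1 - q.\<close>
  have "A powr (- (1 / (q - 1))) \<le> (ln (u x t) powr (1 - q)) powr (- (1 / (q - 1)))"
    using q pos decay(2) unfolding A_def by (intro powr_mono2') auto
  also have "\<dots> = ln (u x t)"
  proof -
    have "(1 - q) * - (1 / (q - 1)) = 1" using q by (simp add: field_simps)
    then show ?thesis unfolding powr_powr using decay(1) by simp
  qed
  finally have "exp (A powr (- (1 / (q - 1)))) \<le> exp (ln (u x t))" by simp
  \<comment> \<open>At t = 0 positivity comes from the datum, since solutions are only required to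
    be positive for t > 0.\<close>
  moreover have "u x t > 0"
    using u x v t by (cases "t = 0") auto
  ultimately show "exp (A powr (- (1 / (q - 1)))) \<le> u x t" by simp
qed

text \<open>The lower bound depends only on the vertex and its datum, so one time
  \<open>\<tau>\<close> and one function serve all solutions. \<open>A\<close> decreases to 0 at
  \<open>\<tau>\<close>, so the bound tends to infinity, and a solution living beyond
  \<open>\<tau>\<close> would give \<open>A \<tau> > 0\<close>.\<close>

lemma blow_up:
  assumes q: "q > 1" and x: "x \<in> V" and v: "u0 x = exp v" "v > 1" "v > out_rate x"
  shows "blows_up_at V E w \<mu> q u0 x"
    and "lifespan V E w \<mu> q u0 \<le> ereal (blowup_time q (out_rate x) v)"
proof -
  define k where "k = (q - 1) * (1 - out_rate x / v powr q)"
  define A where "A = (\<lambda>t. v powr (1 - q) - k * t)"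
  define \<tau> where "\<tau> = v powr (1 - q) / k"
  have k: "k > 0" using q blowup_factor_pos[OF q v(2,3)] by (simp add: k_def)
  have \<tau>: "\<tau> > 0" using k v by (simp add: \<tau>_def)
  have A: "A t > 0 \<longleftrightarrow> t < \<tau>" for t
    using k by (simp add: A_def \<tau>_def field_simps)
  have T: "T \<le> \<tau>" if u: "pointwise_solution V E w \<mu> q u0 T u" for T u
  proof (rule ccontr)
    assume "\<not> T \<le> \<tau>"
    then have "A \<tau> > 0"
      using pointwise_solution_lower_bound(1)[OF q x v u, of \<tau>] \<tau> unfolding A_def k_def by simp
    then show False using A by simp
  qed
  have "filterlim A (at_right 0) (at_left \<tau>)"
  proof (rule tendsto_imp_filterlim_at_right)
    have "(A \<longlongrightarrow> A \<tau>) (at_left \<tau>)"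
      unfolding A_def by (intro tendsto_intros)
    moreover have "A \<tau> = 0" using k by (simp add: A_def \<tau>_def)
    ultimately show "(A \<longlongrightarrow> 0) (at_left \<tau>)" by simp
    show "eventually (\<lambda>t. A t > 0) (at_left \<tau>)"
      unfolding A by (simp add: eventually_at_filter)
  qed
  moreover have "filterlim (\<lambda>a::real. exp (a powr (- (1 / (q - 1))))) at_top (at_right 0)"
    using q by real_asymp
  ultimately have "filterlim (\<lambda>t. exp (A t powr (- (1 / (q - 1))))) at_top (at_left \<tau>)"
    by (rule filterlim_compose[rotated])
  then show "blows_up_at V E w \<mu> q u0 x"
    unfolding blows_up_at_def
    using T \<tau> pointwise_solution_lower_bound(2)[where ?u0.0 = u0, OF q x v]
    by (intro exI[of _ \<tau>] exI[of _ "\<lambda>t. exp (A t powr (- (1 / (q - 1))))"])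
       (auto simp: A_def k_def)
  show "lifespan V E w \<mu> q u0 \<le> ereal (blowup_time q (out_rate x) v)"
    unfolding lifespan_def using T
    by (intro Sup_least) (auto simp: positive_solution_def blowup_time_def \<tau>_def k_def)
qed

end

section \<open>Asymptotics of the lifespan\<close>

lemma le_sup_norm:
  assumes "bounded (f ` V)" "y \<in> V"
  shows "f y \<le> sup_norm V f"
proof -
  have "bdd_above ((\<lambda>x. \<bar>f x\<bar>) ` V)"
    using assms(1) by (force simp: bounded_iff bdd_above_def)
  then have "\<bar>f y\<bar> \<le> sup_norm V f"
    unfolding sup_norm_def using assms(2) by (intro cSUP_upper)
  then show ?thesis by simp
qed

lemma ln_mult_at_top:
  fixes a :: real
  assumes "a > 0"
  shows "filterlim (\<lambda>l. ln (l * a)) at_top at_top"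
  using assms by real_asymp

lemma eventually_ln_mult_gt:
  fixes a c :: real
  assumes "a > 0"
  shows "eventually (\<lambda>l. c < ln (l * a)) at_top"
  using ln_mult_at_top[OF assms] by (simp add: filterlim_at_top_dense)

text \<open>The constants ln a and ln b are negligible against ln l. This is why the choice of
  normalisation does not affect the limit of the scaled lifespan.\<close>

lemma ln_powr_ratio_tendsto:
  fixes a b q :: real
  assumes "a > 0" "b > 0"
  shows "((\<lambda>l. ln (l * a) powr (q - 1) * ln (l * b) powr (1 - q)) \<longlongrightarrow> 1) at_top"
proof -
  have "((\<lambda>l. ln (l * a) / ln (l * b)) \<longlongrightarrow> 1) at_top"
    using assms by real_asymp
  then have "((\<lambda>l. (ln (l * a) / ln (l * b)) powr (q - 1)) \<longlongrightarrow> 1 powr (q - 1)) at_top"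
    by (intro tendsto_intros) auto
  moreover have "eventually (\<lambda>l. (ln (l * a) / ln (l * b)) powr (q - 1) =
      ln (l * a) powr (q - 1) * ln (l * b) powr (1 - q)) at_top"
  proof -
    have "eventually (\<lambda>l. ln (l * a) > 0) at_top" "eventually (\<lambda>l. ln (l * b) > 0) at_top"
      using assms by (simp_all add: eventually_ln_mult_gt)
    then show ?thesis
    proof eventually_elim
      case (elim l)
      then show ?case
        using powr_minus[of "ln (l * b)" "q - 1"] by (subst powr_divide) (auto simp: divide_inverse)
    qed
  qed
  ultimately show ?thesis
    using tendsto_cong by force
qed

context weighted_graph
begin

text \<open>The lifespan is squeezed between \<open>lifespan_ge\<close> with M =
  \<open>l * sup_norm V \<psi>\<close> and \<open>blow_up\<close> at x. The normalising constant a
  is left free so that both limits of the theorem are instances.\<close>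

lemma scaled_lifespan_tendsto:
  assumes q: "q > 1" and \<psi>: "\<And>x. x \<in> V \<Longrightarrow> 0 \<le> \<psi> x" "bounded (\<psi> ` V)"
    and x: "x \<in> V" "\<psi> x > 0" and a: "a > 0"
  shows "((\<lambda>l. ereal (ln (l * a) powr (q - 1)) * lifespan V E w \<mu> q (\<lambda>x. l * \<psi> x))
           \<longlongrightarrow> ereal (1 / (q - 1))) at_top"
proof (rule tendsto_sandwich)
  let ?N = "sup_norm V \<psi>" and ?D = "out_rate x"
  note le = le_sup_norm[OF \<psi>(2)]
  have N: "?N > 0" using le[OF x(1)] x(2) by simp
  show "eventually (\<lambda>l. ereal (ln (l * a) powr (q - 1) * (ln (l * ?N) powr (1 - q) / (q - 1)))
    \<le> ereal (ln (l * a) powr (q - 1)) * lifespan V E w \<mu> q (\<lambda>x. l * \<psi> x)) at_top"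
  proof -
    have "eventually (\<lambda>l. ln (l * ?N) > 0) at_top"
      by (rule eventually_ln_mult_gt[OF N])
    then show ?thesis
      using eventually_gt_at_top[of 0]
    proof eventually_elim
      case (elim l)
      then have "ereal (ln (l * ?N) powr (1 - q) / (q - 1)) \<le> lifespan V E w \<mu> q (\<lambda>x. l * \<psi> x)"
        using le \<psi>(1) x N
        by (intro lifespan_ge[OF q, where ?x0.0 = x]) (auto intro!: mult_left_mono simp: ln_gt_zero_iff)
      from ereal_mult_left_mono[OF this, of "ereal (ln (l * a) powr (q - 1))"]
      show ?case by simp
    qed
  qed
  show "eventually (\<lambda>l. ereal (ln (l * a) powr (q - 1)) * lifespan V E w \<mu> q (\<lambda>x. l * \<psi> x)
    \<le> ereal (ln (l * a) powr (q - 1) * blowup_time q ?D (ln (l * \<psi> x)))) at_top"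
  proof -
    have "eventually (\<lambda>l. ln (l * \<psi> x) > 1) at_top" "eventually (\<lambda>l. ln (l * \<psi> x) > ?D) at_top"
      by (rule eventually_ln_mult_gt[OF x(2)])+
    then show ?thesis
      using eventually_gt_at_top[of 0]
    proof eventually_elim
      case (elim l)
      then have "lifespan V E w \<mu> q (\<lambda>x. l * \<psi> x) \<le> ereal (blowup_time q ?D (ln (l * \<psi> x)))"
        using x by (intro blow_up(2)[OF q]) auto
      from ereal_mult_left_mono[OF this, of "ereal (ln (l * a) powr (q - 1))"]
      show ?case by simp
    qed
  qed
  have "((\<lambda>l. ln (l * a) powr (q - 1) * ln (l * ?N) powr (1 - q) / (q - 1)) \<longlongrightarrow> 1 / (q - 1)) at_top"
    using q by (intro tendsto_intros ln_powr_ratio_tendsto a N) auto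
  then show "((\<lambda>l. ereal (ln (l * a) powr (q - 1) * (ln (l * ?N) powr (1 - q) / (q - 1))))
     \<longlongrightarrow> ereal (1 / (q - 1))) at_top"
    by (intro tendsto_ereal) simp
  have powr_at_top: "filterlim (\<lambda>y. y powr q) at_top at_top"
    using q by real_asymp
  \<comment> \<open>The loss through edges enters only via this factor, which tends to 1 for large
    data.\<close>
  have "((\<lambda>l. 1 - ?D / ln (l * \<psi> x) powr q) \<longlongrightarrow> 1 - 0) at_top"
    using q by (intro tendsto_intros tendsto_divide_0[OF tendsto_const] filterlim_at_top_imp_at_infinity
        filterlim_compose[OF powr_at_top ln_mult_at_top[OF x(2)]])
  then have "((\<lambda>l. ln (l * a) powr (q - 1) * ln (l * \<psi> x) powr (1 - q) /
      ((q - 1) * (1 - ?D / ln (l * \<psi> x) powr q))) \<longlongrightarrow> 1 / ((q - 1) * 1)) at_top"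
    using q by (intro tendsto_intros ln_powr_ratio_tendsto a x(2)) auto
  then show "((\<lambda>l. ereal (ln (l * a) powr (q - 1) * blowup_time q ?D (ln (l * \<psi> x))))
     \<longlongrightarrow> ereal (1 / (q - 1))) at_top"
    unfolding blowup_time_def by (intro tendsto_ereal) simp
qed

end

theorem theorem1p2:
  fixes V :: "'v set" and E :: "'v set set"
    and w :: "'v \<Rightarrow> 'v \<Rightarrow> real" and \<mu> :: "'v \<Rightarrow> real"
  assumes "weighted_graph V E w \<mu>"
    and "D_mu V E w \<mu> < \<infinity>"
  shows "\<exists>C::real. C > 0 \<and>
    (\<forall>(q::real) (\<psi>::'v \<Rightarrow> real).
       q > 1 \<longrightarrow> (\<forall>x\<in>V. \<psi> x \<ge> 0) \<longrightarrow> bounded (\<psi> ` V) \<longrightarrow> (\<exists>x\<in>V. \<psi> x \<noteq> 0) \<longrightarrow>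
       (\<forall>xi\<in>V. \<forall>(m::nat) (lam::real).
          lam > 0 \<longrightarrow> deg E xi = m \<longrightarrow> m \<ge> 1 \<longrightarrow>
          lam * \<psi> xi > C * exp (real m powr (1 / q)) \<longrightarrow>
            blows_up_at V E w \<mu> q (\<lambda>x. lam * \<psi> x) xi \<and>
            lifespan V E w \<mu> q (\<lambda>x. lam * \<psi> x) < \<infinity> \<and>
            (\<exists>L1 L2 :: ereal.
               ((\<lambda>l::real. ereal (ln (l * \<psi> xi) powr (q - 1)) *
                    lifespan V E w \<mu> q (\<lambda>x. l * \<psi> x)) \<longlongrightarrow> L1) at_top \<and>
               ((\<lambda>l::real. ereal (ln (l * sup_norm V \<psi>) powr (q - 1)) *
                    lifespan V E w \<mu> q (\<lambda>x. l * \<psi> x)) \<longlongrightarrow> L2) at_top \<and>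
               L1 \<le> ereal (1 / (q - 1)) \<and> ereal (1 / (q - 1)) \<le> L2)))"
proof -
  interpret weighted_graph V E w \<mu> by fact
  define D where "D = real_of_ereal (D_mu V E w \<mu>)"
  have le_D: "out_rate x \<le> D" if x: "x \<in> V" for x
  proof -
    have "ereal (out_rate x) \<le> D_mu V E w \<mu>"
      unfolding D_mu_def out_rate_def using x by (rule SUP_upper)
    \<comment> \<open>\<open>real_of_ereal\<close> sends infinite values to 0; here the value is
      finite by the hypothesis above and the bound by \<open>out_rate x\<close> below.\<close>
    then show ?thesis
      unfolding D_def using assms(2) by (cases "D_mu V E w \<mu>") auto
  qed
  \<comment> \<open>As \<open>exp (real m powr (1 / q))\<close> is at least 1, exceeding the product
    puts the logarithm of the datum above both 1 and every \<open>out_rate\<close>, as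
    \<open>blow_up\<close> demands. C depends on the graph alone.\<close>
  define C where "C = exp (max 1 D)"
  show ?thesis
  proof (intro exI[of _ C] conjI allI impI ballI)
    show "C > 0" by (simp add: C_def)
    fix q lam :: real and \<psi> :: "'v \<Rightarrow> real" and xi :: 'v and m :: nat
    assume q: "q > 1" and \<psi>: "\<forall>x\<in>V. \<psi> x \<ge> 0" "bounded (\<psi> ` V)"
      and xi: "xi \<in> V" and lam: "lam > 0" and large: "lam * \<psi> xi > C * exp (real m powr (1 / q))"
    have "C * 1 \<le> C * exp (real m powr (1 / q))"
      unfolding C_def by (intro mult_left_mono) auto
    with large have gt: "C < lam * \<psi> xi" by simp
    then have pos: "lam * \<psi> xi > 0"
      unfolding C_def by (rule less_trans[OF exp_gt_zero])
    then have "\<psi> xi > 0" using lam by (simp add: zero_less_mult_iff)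
    have "max 1 D < ln (lam * \<psi> xi)"
      using gt pos unfolding C_def by (metis exp_less_cancel_iff exp_ln)
    then have v: "lam * \<psi> xi = exp (ln (lam * \<psi> xi))" "ln (lam * \<psi> xi) > 1"
        "ln (lam * \<psi> xi) > out_rate xi"
      using pos le_D[OF xi] by auto
    show "blows_up_at V E w \<mu> q (\<lambda>x. lam * \<psi> x) xi"
      by (rule blow_up(1)[where ?u0.0 = "\<lambda>x. lam * \<psi> x", OF q xi v])
    show "lifespan V E w \<mu> q (\<lambda>x. lam * \<psi> x) < \<infinity>"
      using blow_up(2)[where ?u0.0 = "\<lambda>x. lam * \<psi> x", OF q xi v] by (auto simp: less_top[symmetric])
    have "\<psi> xi \<le> sup_norm V \<psi>" by (rule le_sup_norm[OF \<psi>(2) xi])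
    then have "sup_norm V \<psi> > 0" using \<open>\<psi> xi > 0\<close> by simp
    \<comment> \<open>Both witnesses are 1 / (q - 1), obtained with a = \<open>\<psi> xi\<close> and
      a = \<open>sup_norm V \<psi>\<close>.\<close>
    then show "\<exists>L1 L2 :: ereal.
       ((\<lambda>l::real. ereal (ln (l * \<psi> xi) powr (q - 1)) *
            lifespan V E w \<mu> q (\<lambda>x. l * \<psi> x)) \<longlongrightarrow> L1) at_top \<and>
       ((\<lambda>l::real. ereal (ln (l * sup_norm V \<psi>) powr (q - 1)) *
            lifespan V E w \<mu> q (\<lambda>x. l * \<psi> x)) \<longlongrightarrow> L2) at_top \<and>
       L1 \<le> ereal (1 / (q - 1)) \<and> ereal (1 / (q - 1)) \<le> L2"
      using scaled_lifespan_tendsto[OF q _ \<psi>(2) xi \<open>\<psi> xi > 0\<close>] \<psi>(1) \<open>\<psi> xi > 0\<close> by blast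
  qed
qed

end
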